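(* Let $q$ be an odd prime power. There is a constant $c_q$, depending only on $q$, with $0.8414q \leq c_q \leq 0.9184q$, such that the following holds for all positive integers $n,k$: if $M_1, M_2 \in \mathbb{F}_q^{k\times k}$ are matrices such that $M_1$, $M_2$ and $M_1 - M_2$ are all invertible, and $A \subseteq (\mathbb{F}_q^n)^k$ contains no triple of distinct points of the form $\vec{x},\ \vec{x}+M_1\vec{d},\ \vec{x}+M_2\vec{d}$ with $\vec{x},\vec{d} \in (\mathbb{F}_q^n)^k$, then $|A| \leq 3\cdot c_q^{kn}$.
   Context: An element $\vec{x}\in(\mathbb{F}_q^n)^k$ is written as a column $(\vec{x}^{(1)},\dots,\vec{x}^{(k)})^T$ with $\vec{x}^{(i)}\in\mathbb{F}_q^n$, and a matrix $M\in\mathbb{F}_q^{k\times k}$ acts on it by $(M\vec{x})^{(j)}=\sum_{s=1}^k M_{j,s}\vec{x}^{(s)}$. The set of triples $\vec{x},\vec{x}+M_1\vec{d},\vec{x}+M_2\vec{d}$ (with the three points distinct) is called the three-point pattern generated by $M_1,M_2$; it is full-rank when $M_1,M_2,M_1-M_2$ are invertible. *)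

theory Defs
  imports
    Complex_Main
    "HOL-Library.Cardinality"
    "HOL-Number_Theory.Prime_Powers"
    "Jordan_Normal_Form.Matrix"
begin

text \<open>
  A column $x = (x^{(1)},\dots,x^{(k)})^T$ of $k$ vectors from $F^n$ is encoded as the
  $k \times n$ matrix over $F$ whose rows are the $x^{(i)}$ (indices start at 0). Addition is then
  addition in $(F^n)^k$, and the following lemma says that the action of a $k \times k$ matrix $M$,
  $(Mx)^{(j)} = \sum_s M_{j,s} x^{(s)}$, is the matrix product \<^term>\<open>M * x\<close>.
\<close>

lemma mat_action_row:
  fixes M x :: "'a :: comm_semiring_1 mat"
  assumes "M \<in> carrier_mat k k" and "x \<in> carrier_mat k n" and "j < k"
  shows "row (M * x) j = vec n (\<lambda>i. \<Sum>s<k. (M $$ (j, s) \<cdot>\<^sub>v row x s) $ i)"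
  using assms by (intro eq_vecI) (auto simp: scalar_prod_def atLeast0LessThan intro!: sum.cong)

end

theory Submission
  imports Defs
begin

text \<open>
  Let \<open>N1\<close>, \<open>N2\<close> be the inverses of \<open>M1\<close>, \<open>M2\<close>. Points \<open>a, b, c\<close> of a pattern-free set \<open>A\<close>
  satisfy \<open>(N2 - N1) a + N1 b - N2 c = 0\<close> only if \<open>a = b = c\<close>, so by Fermat the product over all
  entries of \<open>1 - L ^ (q - 1)\<close>, with \<open>L\<close> the entry of the left-hand side, is the diagonal tensor on
  \<open>A\<close>, whose slice rank is \<open>card A\<close>. Every monomial of the expanded product has degree at most
  \<open>(q - 1) k n / 3\<close> in one of the three groups of variables, which bounds the slice rank by three
  times the number of exponent vectors of at most this degree. These are counted by weighting each
  with \<open>t\<close> to its degree. Choosing \<open>t ^ ((q - 1) / 2)\<close> independently of \<open>q\<close> makes the case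
  \<open>q = 3\<close> the worst one, so that \<open>c = 0.9184 q\<close> works for every odd \<open>q\<close>.
\<close>

section \<open>Linear algebra over a finite field and the slice rank of a diagonal tensor\<close>

text \<open>Pigeonhole replaces dimension theory: there are more assignments on \<open>X\<close>
  than tuples of values of the forms, so two assignments collide and their difference is a solution.
  Extending it by 0 outside \<open>X\<close> lets it be added to a function supported
  elsewhere.\<close>

lemma homogeneous_system_nontrivial:
  fixes f :: "'s \<Rightarrow> 'x \<Rightarrow> 'a :: {field, finite}"
  assumes "finite X" "finite S" "card S < card X"
  obtains h where "\<And>x. x \<notin> X \<Longrightarrow> h x = 0" "\<exists>x\<in>X. h x \<noteq> 0"
    "\<And>s. s \<in> S \<Longrightarrow> (\<Sum>x\<in>X. h x * f s x) = 0"
proof -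
  define ev where "ev h = (\<lambda>s\<in>S. \<Sum>x\<in>X. h x * f s x)" for h :: "'x \<Rightarrow> 'a"
  let ?D = "PiE X (\<lambda>_. UNIV :: 'a set)" and ?R = "PiE S (\<lambda>_. UNIV :: 'a set)"
  \<comment> \<open>With at least two field elements, the larger exponent gives the strictly larger
    power.\<close>
  have "card {0, 1 :: 'a} \<le> CARD('a)"
    by (intro card_mono) auto
  then have "card ?R < card ?D"
    using assms by (simp add: card_PiE)
  moreover have "ev ` ?D \<subseteq> ?R" and "finite ?R"
    using assms by (auto simp: ev_def intro!: finite_PiE)
  ultimately have "\<not> inj_on ev ?D"
    by (metis card_inj_on_le linorder_not_less)
  then obtain g h where gh: "g \<in> ?D" "h \<in> ?D" "ev g = ev h" "g \<noteq> h"
    by (auto simp: inj_on_def)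
  show thesis
  proof (rule that)
    show "(if x \<in> X then g x - h x else 0) = 0" if "x \<notin> X" for x
      using that by simp
    show "\<exists>x\<in>X. (if x \<in> X then g x - h x else 0) \<noteq> 0"
      using gh PiE_ext[OF gh(1,2)] by auto
    show "(\<Sum>x\<in>X. (if x \<in> X then g x - h x else 0) * f s x) = 0" if "s \<in> S" for s
      using fun_cong[OF gh(3), of s] that
      by (simp add: ev_def left_diff_distrib sum_subtractf)
  qed
qed

text \<open>Take a solution with the largest support. If it missed more than \<open>card S\<close>
  points of \<open>X\<close>, a nonzero solution living on the missed points could be added to it
  without cancellation, enlarging the support.\<close>

lemma orthogonal_large_support:
  fixes f :: "'s \<Rightarrow> 'x \<Rightarrow> 'a :: {field, finite}"
  assumes "finite X" "finite S"
  obtains h where "\<And>s. s \<in> S \<Longrightarrow> (\<Sum>x\<in>X. h x * f s x) = 0"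
    "card X \<le> card {x\<in>X. h x \<noteq> 0} + card S"
proof -
  define P where "P h \<longleftrightarrow> (\<forall>s\<in>S. (\<Sum>x\<in>X. h x * f s x) = 0)" for h
  define supp where "supp h = {x\<in>X. h x \<noteq> 0}" for h :: "'x \<Rightarrow> 'a"
  have "P (\<lambda>_. 0)"
    by (simp add: P_def)
  moreover have "\<forall>h. P h \<longrightarrow> card (supp h) < Suc (card X)"
    using assms by (auto simp: supp_def less_Suc_eq_le intro!: card_mono)
  ultimately obtain h where h: "P h" "\<And>g. P g \<Longrightarrow> card (supp g) \<le> card (supp h)"
    using ex_has_greatest_nat[of P _ "\<lambda>h. card (supp h)"] by blast
  have "card X \<le> card (supp h) + card S"
  proof (rule ccontr)
    assume less: "\<not> ?thesis"
    have sub: "supp h \<subseteq> X" and fin: "finite (supp h)"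
      using assms by (auto simp: supp_def)
    have "card S < card (X - supp h)"
      using less card_Diff_subset[OF fin sub] by linarith
    then obtain g where g: "\<And>x. x \<notin> X - supp h \<Longrightarrow> g x = 0" "\<exists>x\<in>X - supp h. g x \<noteq> 0"
      "\<And>s. s \<in> S \<Longrightarrow> (\<Sum>x\<in>X - supp h. g x * f s x) = 0"
      using homogeneous_system_nontrivial[of "X - supp h" S f] assms by blast
    have "(\<Sum>x\<in>X. g x * f s x) = 0" if "s \<in> S" for s
      using g(3)[OF that] sum.mono_neutral_left[of X "X - supp h" "\<lambda>x. g x * f s x"] assms g(1)
      by auto
    with h(1) have "P (\<lambda>x. h x + g x)"
      by (simp add: P_def distrib_right sum.distrib)
    moreover have "supp h \<subset> supp (\<lambda>x. h x + g x)"
      using g(1,2) by (auto simp: supp_def)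
    ultimately show False
      using h(2) psubset_card_mono[of "supp (\<lambda>x. h x + g x)" "supp h"] assms
      by (fastforce simp: supp_def)
  qed
  with h(1) show thesis
    by (intro that[of h]) (auto simp: P_def supp_def)
qed

text \<open>A diagonal matrix with nonzero diagonal has full rank, while a sum of
  \<open>card S\<close> products has rank at most \<open>card S\<close>: otherwise some nonzero
  \<open>y\<close> is orthogonal to every \<open>p s\<close> and hence annihilates the
  matrix.\<close>

lemma card_le_rank_diagonal:
  fixes p r :: "'s \<Rightarrow> 'x \<Rightarrow> 'a :: {field, finite}"
  assumes "finite T" "finite S" and nz: "\<And>b. b \<in> T \<Longrightarrow> h b \<noteq> 0"
    and eq: "\<And>b c. b \<in> T \<Longrightarrow> c \<in> T \<Longrightarrow> (\<Sum>s\<in>S. p s b * r s c) = (if b = c then h b else 0)"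
  shows "card T \<le> card S"
proof (rule ccontr)
  assume "\<not> ?thesis"
  then obtain y where y: "\<exists>x\<in>T. y x \<noteq> 0" "\<And>s. s \<in> S \<Longrightarrow> (\<Sum>x\<in>T. y x * p s x) = 0"
    using homogeneous_system_nontrivial[of T S p] assms by (metis not_le_imp_less)
  then obtain c where c: "c \<in> T" "y c \<noteq> 0"
    by blast
  have "y c * h c = (\<Sum>b\<in>T. y b * (\<Sum>s\<in>S. p s b * r s c))"
    using c \<open>finite T\<close> by (simp add: eq if_distrib cong: sum.cong if_cong)
  also have "\<dots> = (\<Sum>s\<in>S. (\<Sum>b\<in>T. y b * p s b) * r s c)"
    by (simp add: sum_distrib_left sum_distrib_right mult.assoc) (rule sum.swap)
  also have "\<dots> = 0"
    using y by simp
  finally show False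
    using c nz by simp
qed

text \<open>Tao's slice rank argument. Contracting the first variable with an \<open>h\<close>
  orthogonal to all \<open>f1 s\<close> kills the first group and leaves the diagonal matrix of
  \<open>h\<close>. Its rank is at most \<open>card S2 + card S3\<close>, and \<open>h\<close> can
  be chosen nonzero at \<open>card A - card S1\<close> points or more.\<close>

lemma card_le_slice_rank_diagonal:
  fixes f1 f2 f3 :: "'s \<Rightarrow> 'x \<Rightarrow> 'a :: {field, finite}"
  assumes "finite A" "finite S1" "finite S2" "finite S3"
    and eq: "\<And>a b c. a \<in> A \<Longrightarrow> b \<in> A \<Longrightarrow> c \<in> A \<Longrightarrow>
      (\<Sum>s\<in>S1. f1 s a * g1 s b c) + (\<Sum>s\<in>S2. f2 s b * g2 s a c) + (\<Sum>s\<in>S3. f3 s c * g3 s a b)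
      = (if a = b \<and> b = c then 1 else 0)"
  shows "card A \<le> card S1 + card S2 + card S3"
proof -
  obtain h where h: "\<And>s. s \<in> S1 \<Longrightarrow> (\<Sum>a\<in>A. h a * f1 s a) = 0"
    and card: "card A \<le> card {a\<in>A. h a \<noteq> 0} + card S1"
    using orthogonal_large_support assms by blast
  let ?T = "{a\<in>A. h a \<noteq> 0}"
  \<comment> \<open>After the contraction each remaining term is a function of \<open>b\<close>
    times a function of \<open>c\<close>. The tags \<open>Inl\<close> and \<open>Inr\<close> merge
    the two groups into one index set.\<close>
  define p where "p s b = (case s of Inl s \<Rightarrow> f2 s b | Inr s \<Rightarrow> \<Sum>a\<in>A. h a * g3 s a b)" for s b
  define r where "r s c = (case s of Inl s \<Rightarrow> \<Sum>a\<in>A. h a * g2 s a c | Inr s \<Rightarrow> f3 s c)" for s c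
  have "card ?T \<le> card (S2 <+> S3)"
  proof (rule card_le_rank_diagonal)
    fix b c assume bc: "b \<in> ?T" "c \<in> ?T"
    have 1: "(\<Sum>a\<in>A. h a * (\<Sum>s\<in>S1. f1 s a * g1 s b c)) = (\<Sum>s\<in>S1. (\<Sum>a\<in>A. h a * f1 s a) * g1 s b c)"
      by (simp add: sum_distrib_left sum_distrib_right mult.assoc) (rule sum.swap)
    have 2: "(\<Sum>a\<in>A. h a * (\<Sum>s\<in>S2. f2 s b * g2 s a c)) = (\<Sum>s\<in>S2. f2 s b * (\<Sum>a\<in>A. h a * g2 s a c))"
      by (simp add: sum_distrib_left mult.left_commute) (rule sum.swap)
    have 3: "(\<Sum>a\<in>A. h a * (\<Sum>s\<in>S3. f3 s c * g3 s a b)) = (\<Sum>s\<in>S3. (\<Sum>a\<in>A. h a * g3 s a b) * f3 s c)"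
      by (simp add: sum_distrib_left sum_distrib_right mult_ac) (rule sum.swap)
    have "(if b = c then h b else 0) = (\<Sum>a\<in>A. if a = b then h b * (if b = c then 1 else 0) else 0)"
      using bc assms by simp
    also have "\<dots> = (\<Sum>a\<in>A. h a * (if a = b \<and> b = c then 1 else 0))"
      by (intro sum.cong) auto
    also have "\<dots> = (\<Sum>a\<in>A. h a * ((\<Sum>s\<in>S1. f1 s a * g1 s b c) +
        (\<Sum>s\<in>S2. f2 s b * g2 s a c) + (\<Sum>s\<in>S3. f3 s c * g3 s a b)))"
      using bc by (intro sum.cong refl) (subst eq, auto)
    also have "\<dots> = (\<Sum>s\<in>S2. f2 s b * (\<Sum>a\<in>A. h a * g2 s a c)) +
        (\<Sum>s\<in>S3. (\<Sum>a\<in>A. h a * g3 s a b) * f3 s c)"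
      by (simp add: distrib_left sum.distrib 1 2 3 h)
    also have "\<dots> = (\<Sum>s\<in>S2 <+> S3. p s b * r s c)"
      using assms by (simp add: sum.Plus p_def r_def)
    finally show "(\<Sum>s\<in>S2 <+> S3. p s b * r s c) = (if b = c then h b else 0)" ..
  qed (use assms in auto)
  with card assms show ?thesis
    by (simp add: card_Plus)
qed

section \<open>The polynomial method\<close>

text \<open>Multiplication by \<open>x\<close> permutes the nonzero elements, so it leaves their
  nonzero product unchanged.\<close>

lemma finite_field_power_card_minus_one:
  fixes x :: "'a :: {field, finite}"
  assumes "x \<noteq> 0"
  shows "x ^ (CARD('a) - 1) = 1"
proof -
  let ?U = "- {0 :: 'a}"
  have "bij_betw ((*) x) ?U ?U"
    using assms by (intro bij_betw_byWitness[of _ "\<lambda>y. y / x"]) auto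
  then have "(\<Prod>y\<in>?U. x * y) = \<Prod>?U"
    by (rule prod.reindex_bij_betw)
  then have "x ^ card ?U * \<Prod>?U = 1 * \<Prod>?U"
    by (simp add: prod.distrib)
  moreover have "\<Prod>?U \<noteq> 0"
    by simp
  ultimately have "x ^ card ?U = 1"
    by (metis mult_right_cancel)
  then show ?thesis
    by (simp add: Compl_eq_Diff_UNIV card_Diff_singleton)
qed

text \<open>The total degree is bounded by \<open>m\<close> rather than equal to \<open>m\<close>,
  so that the constant term of \<open>1 - (x + y + z) ^ m\<close> has an index too.\<close>

definition triples_upto :: "nat \<Rightarrow> (nat \<times> nat \<times> nat) set" where
  "triples_upto m = {(i, j, l). i + j + l \<le> m}"

lemma finite_triples_upto: "finite (triples_upto m)"
  by (rule finite_subset[of _ "{..m} \<times> {..m} \<times> {..m}"]) (auto simp: triples_upto_def)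

text \<open>The binomial theorem applied twice. Both terms are put over one index set, with
  coefficients free of \<open>x\<close>, \<open>y\<close>, \<open>z\<close>, so that a product of
  such factors can be expanded over functions into \<open>triples_upto m\<close>.\<close>

lemma trinomial_expansion:
  fixes x y z :: "'a :: comm_ring_1"
  shows "1 - (x + y + z) ^ m = (\<Sum>(i, j, l)\<in>triples_upto m.
    ((if i = 0 \<and> j = 0 \<and> l = 0 then 1 else 0) -
     (if i + j + l = m then of_nat (m choose i) * of_nat ((m - i) choose j) else 0)) *
    x ^ i * y ^ j * z ^ l)"
proof -
  let ?c = "\<lambda>i j. of_nat (m choose i) * of_nat ((m - i) choose j) :: 'a"
  have "(x + y + z) ^ m = (x + (y + z)) ^ m"
    by (simp add: add.assoc)
  also have "\<dots> = (\<Sum>i\<le>m. \<Sum>j\<le>m - i. ?c i j * x ^ i * y ^ j * z ^ (m - i - j))"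
    by (subst binomial_ring, subst binomial_ring)
       (simp add: sum_distrib_left sum_distrib_right mult_ac)
  also have "\<dots> = (\<Sum>(i, j)\<in>Sigma {..m} (\<lambda>i. {..m - i}). ?c i j * x ^ i * y ^ j * z ^ (m - i - j))"
    by (subst sum.Sigma) auto
  also have "\<dots> = (\<Sum>(i, j, l)\<in>{(i, j, l). i + j + l = m}. ?c i j * x ^ i * y ^ j * z ^ l)"
    by (rule sum.reindex_bij_witness[of _ "\<lambda>(i, j, l). (i, j)" "\<lambda>(i, j). (i, j, m - i - j)"]) auto
  also have "\<dots> = (\<Sum>(i, j, l)\<in>triples_upto m.
      (if i + j + l = m then ?c i j else 0) * x ^ i * y ^ j * z ^ l)"
    by (rule sum.mono_neutral_cong_left[OF finite_triples_upto])
       (auto simp: triples_upto_def split: if_splits)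
  finally have *: "(x + y + z) ^ m = \<dots>" .
  have "1 = (\<Sum>(i, j, l)\<in>triples_upto m.
      (if i = 0 \<and> j = 0 \<and> l = 0 then 1 else 0) * x ^ i * y ^ j * z ^ l)"
    by (subst sum.mono_neutral_right[of _ "{(0, 0, 0)}"])
       (auto simp: finite_triples_upto, auto simp: triples_upto_def split: if_splits)
  with * show ?thesis
    by (simp add: left_diff_distrib sum_subtractf case_prod_beta)
qed

definition low_degree :: "'i set \<Rightarrow> nat \<Rightarrow> ('i \<Rightarrow> nat) set" where
  "low_degree I m = {s \<in> PiE I (\<lambda>_. {..m}). 3 * sum s I \<le> m * card I}"

lemma finite_low_degree: "finite I \<Longrightarrow> finite (low_degree I m)"
  by (auto simp: low_degree_def intro!: finite_PiE)

text \<open>Only the shape of the test matters: in each coordinate it is a sum of functions of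
  single points. Every monomial of the expanded product then splits into factors in
  \<open>a\<close>, \<open>b\<close> and \<open>c\<close>, and a factor of low degree can serve as
  its slice.\<close>

lemma card_le_low_degree:
  fixes u v w :: "'x \<Rightarrow> 'i \<Rightarrow> 'a :: {field, finite}"
  assumes "finite A" "finite I"
    and zero: "\<And>a b c. a \<in> A \<Longrightarrow> b \<in> A \<Longrightarrow> c \<in> A \<Longrightarrow>
      (\<forall>i\<in>I. u a i + v b i + w c i = 0) \<longleftrightarrow> a = b \<and> b = c"
  shows "card A \<le> 3 * card (low_degree I (CARD('a) - 1))"
proof -
  define m where "m = CARD('a) - 1"
  have "card {0, 1 :: 'a} \<le> CARD('a)"
    by (intro card_mono) auto
  \<comment> \<open>Positivity gives \<open>0 ^ m = 0\<close>, so a vanishing sum contributes the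
    factor 1 to the product below.\<close>
  then have "m > 0"
    by (simp add: m_def)
  define G where "G = PiE I (\<lambda>_. triples_upto m)"
  define S where "S = low_degree I m"
  define e1 where "e1 g = (\<lambda>i\<in>I. fst (g i))" for g :: "'i \<Rightarrow> nat \<times> nat \<times> nat"
  define e2 where "e2 g = (\<lambda>i\<in>I. fst (snd (g i)))" for g :: "'i \<Rightarrow> nat \<times> nat \<times> nat"
  define e3 where "e3 g = (\<lambda>i\<in>I. snd (snd (g i)))" for g :: "'i \<Rightarrow> nat \<times> nat \<times> nat"
  \<comment> \<open>Each monomial is filed under its first factor of low degree, which makes the
    three classes disjoint; \<open>G3\<close> takes whatever is left.\<close>
  define G1 where "G1 = {g\<in>G. e1 g \<in> S}"
  define G2 where "G2 = {g\<in>G. e1 g \<notin> S \<and> e2 g \<in> S}"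
  define G3 where "G3 = {g\<in>G. e1 g \<notin> S \<and> e2 g \<notin> S}"
  have "finite G"
    using assms finite_triples_upto by (auto simp: G_def intro!: finite_PiE)
  then have fin: "finite G" "finite S" "finite G1" "finite G2" "finite G3"
    using assms by (simp_all add: S_def G1_def G2_def G3_def finite_low_degree)
  \<comment> \<open>The three degrees add up to at most \<open>m * card I\<close>. If the first two
    both exceed a third of this, the last is below a third.\<close>
  have G3: "e3 g \<in> S" if "g \<in> G3" for g
  proof -
    from that have g: "g i \<in> triples_upto m" if "i \<in> I" for i
      using that by (auto simp: G3_def G_def)
    have e: "e1 g \<in> PiE I (\<lambda>_. {..m})" "e2 g \<in> PiE I (\<lambda>_. {..m})" "e3 g \<in> PiE I (\<lambda>_. {..m})"
      using g by (fastforce simp: e1_def e2_def e3_def triples_upto_def)+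
    have "sum (e1 g) I + sum (e2 g) I + sum (e3 g) I = (\<Sum>i\<in>I. e1 g i + e2 g i + e3 g i)"
      by (simp add: sum.distrib)
    also have "\<dots> \<le> (\<Sum>i\<in>I. m)"
      using g by (intro sum_mono) (fastforce simp: e1_def e2_def e3_def triples_upto_def)
    finally show ?thesis
      using e that by (auto simp: G3_def S_def low_degree_def mult.commute)
  qed
  define cf :: "nat \<times> nat \<times> nat \<Rightarrow> 'a" where
    "cf = (\<lambda>(i, j, l). (if i = 0 \<and> j = 0 \<and> l = 0 then 1 else 0) -
       (if i + j + l = m then of_nat (m choose i) * of_nat ((m - i) choose j) else 0))"
  define C where "C g = (\<Prod>i\<in>I. cf (g i))" for g
  define mon where "mon s x = (\<Prod>i\<in>I. x i ^ s i)" for s and x :: "'i \<Rightarrow> 'a"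
  define F where "F g a b c = C g * mon (e1 g) (u a) * mon (e2 g) (v b) * mon (e3 g) (w c)"
    for g a b c
  have total: "(\<Sum>g\<in>G. F g a b c) = (if a = b \<and> b = c then 1 else 0)"
    if "a \<in> A" "b \<in> A" "c \<in> A" for a b c
  proof -
    have "(if a = b \<and> b = c then 1 else 0) = (\<Prod>i\<in>I. 1 - (u a i + v b i + w c i) ^ m)"
    proof (cases "\<forall>i\<in>I. u a i + v b i + w c i = 0")
      case True
      then show ?thesis
        using zero[OF that] \<open>m > 0\<close> by (simp add: zero_power)
    next
      case False
      then obtain i where i: "i \<in> I" "u a i + v b i + w c i \<noteq> 0"
        by blast
      then have "1 - (u a i + v b i + w c i) ^ m = 0"
        using finite_field_power_card_minus_one[OF i(2)] by (simp add: m_def)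
      then have "(\<Prod>i\<in>I. 1 - (u a i + v b i + w c i) ^ m) = 0"
        using i assms(2) by (intro prod_zero) auto
      then show ?thesis
        using False zero[OF that] by auto
    qed
    also have "\<dots> = (\<Prod>i\<in>I. \<Sum>e\<in>triples_upto m.
        cf e * u a i ^ fst e * v b i ^ fst (snd e) * w c i ^ snd (snd e))"
      by (simp add: trinomial_expansion cf_def case_prod_beta)
    also have "\<dots> = (\<Sum>g\<in>G. \<Prod>i\<in>I.
        cf (g i) * u a i ^ fst (g i) * v b i ^ fst (snd (g i)) * w c i ^ snd (snd (g i)))"
      unfolding G_def by (rule prod_sum_PiE) (use assms finite_triples_upto in auto)
    also have "\<dots> = (\<Sum>g\<in>G. F g a b c)"
      by (simp add: F_def C_def mon_def e1_def e2_def e3_def prod.distrib)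
    finally show ?thesis ..
  qed
  have split: "(\<Sum>g\<in>G. H g) = (\<Sum>g\<in>G1. H g) + (\<Sum>g\<in>G2. H g) + (\<Sum>g\<in>G3. H g)"
    for H :: "_ \<Rightarrow> 'a"
  proof -
    have "G = (G1 \<union> G2) \<union> G3"
      by (auto simp: G1_def G2_def G3_def)
    moreover have "sum H ((G1 \<union> G2) \<union> G3) = sum H G1 + sum H G2 + sum H G3"
      using fin by (subst sum.union_disjoint; (subst sum.union_disjoint)?)
        (auto simp: G1_def G2_def G3_def)
    ultimately show ?thesis
      by simp
  qed
  \<comment> \<open>Monomials sharing the low-degree factor \<open>s\<close> are collected; their
    cofactors involve only the other two points, so each \<open>s\<close> costs a single
    slice.\<close>
  define g1 where "g1 s b c = (\<Sum>g\<in>{g\<in>G1. e1 g = s}. C g * mon (e2 g) (v b) * mon (e3 g) (w c))"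
    for s b c
  define g2 where "g2 s a c = (\<Sum>g\<in>{g\<in>G2. e2 g = s}. C g * mon (e1 g) (u a) * mon (e3 g) (w c))"
    for s a c
  define g3 where "g3 s a b = (\<Sum>g\<in>{g\<in>G3. e3 g = s}. C g * mon (e1 g) (u a) * mon (e2 g) (v b))"
    for s a b
  have 1: "(\<Sum>s\<in>S. mon s (u a) * g1 s b c) = (\<Sum>g\<in>G1. F g a b c)" for a b c
    by (subst sum.group[of G1 S e1, symmetric])
       (use fin in \<open>auto simp: G1_def g1_def F_def sum_distrib_left mult_ac intro!: sum.cong\<close>)
  have 2: "(\<Sum>s\<in>S. mon s (v b) * g2 s a c) = (\<Sum>g\<in>G2. F g a b c)" for a b c
    by (subst sum.group[of G2 S e2, symmetric])
       (use fin in \<open>auto simp: G2_def g2_def F_def sum_distrib_left mult_ac intro!: sum.cong\<close>)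
  have 3: "(\<Sum>s\<in>S. mon s (w c) * g3 s a b) = (\<Sum>g\<in>G3. F g a b c)" for a b c
    by (subst sum.group[of G3 S e3, symmetric])
       (use fin G3 in \<open>auto simp: g3_def F_def sum_distrib_left mult_ac intro!: sum.cong\<close>)
  have "card A \<le> card S + card S + card S"
    by (rule card_le_slice_rank_diagonal[where ?f1.0 = "\<lambda>s a. mon s (u a)" and ?f2.0 = "\<lambda>s b. mon s (v b)"
          and ?f3.0 = "\<lambda>s c. mon s (w c)" and ?g1.0 = g1 and ?g2.0 = g2 and ?g3.0 = g3])
       (use fin assms in \<open>auto simp: 1 2 3 split[symmetric] total\<close>)
  then show ?thesis
    by (simp add: S_def m_def)
qed

section \<open>Counting exponent vectors of low degree\<close>

text \<open>The mean of all the powers is at most the mean of the three powers with exponents 0,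
  \<open>p\<close> and \<open>2 * p\<close>, with equality for \<open>p = 1\<close>. This is what
  makes \<open>q = 3\<close> the worst case.\<close>

lemma geometric_sum_le:
  fixes t :: real
  assumes "0 \<le> t" "t \<le> 1" "p > 0"
  shows "(\<Sum>j\<le>2 * p. t ^ j) \<le> real (2 * p + 1) * (1 + t ^ p + (t ^ p)\<^sup>2) / 3"
proof -
  define \<tau> where "\<tau> = t ^ p"
  have tau: "0 \<le> \<tau>" "\<tau> \<le> 1"
    using assms by (auto simp: \<tau>_def power_le_one)
  have pair: "t ^ j + t ^ (p - j) \<le> 1 + \<tau>" if "j \<le> p" for j
  proof -
    have "0 \<le> (1 - t ^ j) * (1 - t ^ (p - j))"
      using assms by (intro mult_nonneg_nonneg) (auto simp: power_le_one)
    also have "\<dots> = 1 - t ^ j - t ^ (p - j) + t ^ (j + (p - j))"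
      by (simp add: algebra_simps power_add)
    finally show ?thesis
      using that by (simp add: \<tau>_def)
  qed
  have "2 * (\<Sum>j\<le>p. t ^ j) = (\<Sum>j\<le>p. t ^ j) + (\<Sum>j\<le>p. t ^ (p - j))"
    using sum.nat_diff_reindex[of "\<lambda>j. t ^ j" "Suc p"] by (simp add: lessThan_Suc_atMost)
  also have "\<dots> = (\<Sum>j\<le>p. t ^ j + t ^ (p - j))"
    by (simp add: sum.distrib)
  also have "\<dots> \<le> (\<Sum>j\<le>p. 1 + \<tau>)"
    using pair by (intro sum_mono) auto
  finally have half: "2 * (\<Sum>j\<le>p. t ^ j) \<le> real (p + 1) * (1 + \<tau>)"
    by simp
  \<comment> \<open>Both halves reduce to the sum up to \<open>p\<close>; the middle power
    \<open>t ^ p\<close> would be counted twice, hence the correction by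
    \<open>\<tau>\<close>.\<close>
  have "(\<Sum>j\<le>2 * p. t ^ j) = (\<Sum>j<p. t ^ j) + (\<Sum>j=p..2*p. t ^ j)"
    using assms by (subst sum.union_disjoint[symmetric]) (auto intro!: sum.cong)
  also have "(\<Sum>j=p..2*p. t ^ j) = (\<Sum>j\<le>p. t ^ (p + j))"
    by (rule sum.reindex_bij_witness[of _ "\<lambda>j. p + j" "\<lambda>j. j - p"]) auto
  also have "\<dots> = \<tau> * (\<Sum>j\<le>p. t ^ j)"
    by (simp add: power_add sum_distrib_left \<tau>_def)
  also have "(\<Sum>j<p. t ^ j) = (\<Sum>j\<le>p. t ^ j) - \<tau>"
    by (simp add: lessThan_Suc_atMost[symmetric] \<tau>_def)
  finally have "2 * (\<Sum>j\<le>2 * p. t ^ j) = (1 + \<tau>) * (2 * (\<Sum>j\<le>p. t ^ j)) - 2 * \<tau>"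
    by (simp add: algebra_simps)
  also have "\<dots> \<le> (1 + \<tau>) * (real (p + 1) * (1 + \<tau>)) - 2 * \<tau>"
    using half tau by (intro diff_right_mono mult_left_mono) auto
  also have "\<dots> \<le> 2 * (real (2 * p + 1) * (1 + \<tau> + \<tau>\<^sup>2) / 3)"
  proof -
    \<comment> \<open>This is exactly three times the difference of the two sides.\<close>
    have "0 \<le> (real p - 1) * (1 - \<tau>)\<^sup>2"
      using assms by simp
    then show ?thesis
      by (simp add: algebra_simps power2_eq_square)
  qed
  finally show ?thesis
    by (simp add: \<tau>_def)
qed

text \<open>Each counted vector has weight at least \<open>\<kappa> ^ (2 * card I)\<close>, while
  the total weight of the whole box factors into \<open>card I\<close> equal geometric sums.\<close>

lemma card_low_degree_le:
  assumes "finite I" "p > 0"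
  shows "real (card (low_degree I (2 * p))) \<le> (0.9184 * real (2 * p + 1)) ^ card I"
proof -
  \<comment> \<open>\<open>\<kappa>\<close> is close to the cube root of \<open>(sqrt 33 - 1) / 8\<close>, which minimises
    \<open>(1 + x + x\<^sup>2) / x powr (2/3)\<close>.\<close>
  define \<kappa> :: real where "\<kappa> = 0.8402"
  \<comment> \<open>Now \<open>t ^ p\<close> is the same for all \<open>p\<close>, and the cube
    makes \<open>t\<close> to the power \<open>2 * p / 3\<close> equal to
    \<open>\<kappa>\<^sup>2\<close>; comparing cubes below then avoids fractional exponents.\<close>
  define t where "t = root p (\<kappa> ^ 3)"
  have t: "0 < t" "t \<le> 1" "t ^ p = \<kappa> ^ 3"
    using assms by (auto simp: t_def \<kappa>_def real_root_pow_pos power_le_one)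
  define N where "N = card I"
  have ge: "\<kappa> ^ (2 * N) \<le> (\<Prod>i\<in>I. t ^ s i)" if "s \<in> low_degree I (2 * p)" for s
  proof -
    have "3 * sum s I \<le> p * (2 * N)"
      using that by (simp add: low_degree_def N_def)
    then have "t ^ (p * (2 * N)) \<le> t ^ (3 * sum s I)"
      using t by (intro power_decreasing) auto
    then have "(\<kappa> ^ (2 * N)) ^ 3 \<le> (t ^ sum s I) ^ 3"
      unfolding power_mult[of t p] t(3) by (simp add: mult.commute flip: power_mult)
    then have "\<kappa> ^ (2 * N) \<le> t ^ sum s I"
      using t by (subst (asm) power_mono_iff) (auto simp: \<kappa>_def)
    then show ?thesis
      by (simp add: power_sum)
  qed
  have "real (card (low_degree I (2 * p))) * \<kappa> ^ (2 * N) = (\<Sum>s\<in>low_degree I (2 * p). \<kappa> ^ (2 * N))"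
    by simp
  also have "\<dots> \<le> (\<Sum>s\<in>low_degree I (2 * p). \<Prod>i\<in>I. t ^ s i)"
    using ge by (intro sum_mono) auto
  also have "\<dots> \<le> (\<Sum>s\<in>PiE I (\<lambda>_. {..2 * p}). \<Prod>i\<in>I. t ^ s i)"
    using assms t by (intro sum_mono2) (auto simp: low_degree_def intro!: finite_PiE prod_nonneg)
  also have "\<dots> = (\<Sum>j\<le>2 * p. t ^ j) ^ N"
    using assms by (subst prod_sum_PiE[symmetric]) (auto simp: N_def)
  also have "\<dots> \<le> (0.9184 * real (2 * p + 1) * \<kappa>\<^sup>2) ^ N"
  proof (rule power_mono)
    have "(\<Sum>j\<le>2 * p. t ^ j) \<le> real (2 * p + 1) * ((1 + \<kappa> ^ 3 + (\<kappa> ^ 3)\<^sup>2) / 3)"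
      using geometric_sum_le[of t p] t assms by simp
    \<comment> \<open>Numerically
      \<open>(1 + \<kappa> ^ 3 + \<kappa> ^ 6) / (3 * \<kappa>\<^sup>2)\<close> is about
      0.91837.\<close>
    also have "\<dots> \<le> real (2 * p + 1) * (0.9184 * \<kappa>\<^sup>2)"
      by (rule mult_left_mono) (simp_all add: \<kappa>_def power_divide)
    finally show "(\<Sum>j\<le>2 * p. t ^ j) \<le> 0.9184 * real (2 * p + 1) * \<kappa>\<^sup>2"
      by (simp add: mult_ac)
  qed (use t in \<open>auto intro!: sum_nonneg\<close>)
  also have "\<dots> = (0.9184 * real (2 * p + 1)) ^ N * \<kappa> ^ (2 * N)"
    by (simp only: power_mult_distrib power_mult)
  finally show ?thesis
    by (simp add: N_def \<kappa>_def)
qed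

section \<open>Full-rank matrix patterns\<close>

lemma invertible_mat_obtain_inverse:
  assumes "M \<in> carrier_mat k k" "invertible_mat M"
  obtains M' where "M' \<in> carrier_mat k k" "M' * M = 1\<^sub>m k" "M * M' = 1\<^sub>m k"
proof -
  from assms obtain B where B: "M * B = 1\<^sub>m k" "B * M = 1\<^sub>m (dim_row B)"
    by (auto simp: invertible_mat_def inverts_mat_def)
  \<comment> \<open>\<open>invertible_mat\<close> leaves the shape of \<open>B\<close> open; it is
    read off from the two product identities.\<close>
  have "dim_col B = k"
    using arg_cong[OF B(1), of dim_col] by simp
  moreover have "dim_row B = k"
    using arg_cong[OF B(2), of dim_col] assms by simp
  ultimately show thesis
    using that[of B] B by auto
qed

lemma invertible_mat_mult_eq_zero:
  fixes M :: "'a :: comm_ring_1 mat"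
  assumes "M \<in> carrier_mat k k" "invertible_mat M" "d \<in> carrier_mat k n" "M * d = 0\<^sub>m k n"
  shows "d = 0\<^sub>m k n"
proof -
  obtain M' where M': "M' \<in> carrier_mat k k" "M' * M = 1\<^sub>m k"
    using invertible_mat_obtain_inverse assms by blast
  have "d = M' * M * d"
    using assms M' left_mult_one_mat[of d k n] by simp
  also have "\<dots> = M' * (M * d)"
    using assms M' by (intro assoc_mult_mat)
  also have "\<dots> = 0\<^sub>m k n"
    using assms M' by simp
  finally show ?thesis .
qed

lemma add_mat_eq_self_iff:
  fixes x y :: "'a :: ab_group_add mat"
  assumes "x \<in> carrier_mat k n" "y \<in> carrier_mat k n"
  shows "x = x + y \<longleftrightarrow> y = 0\<^sub>m k n"
  using assms by (auto simp: mat_eq_iff)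

text \<open>The differences of the points are, up to sign, the images of \<open>d\<close> under
  \<open>M1\<close>, \<open>M2\<close> and \<open>M1 - M2\<close>, and an invertible matrix does not
  annihilate \<open>d\<close>.\<close>

lemma full_rank_pattern_distinct:
  fixes M1 M2 :: "'a :: comm_ring_1 mat"
  assumes M: "M1 \<in> carrier_mat k k" "M2 \<in> carrier_mat k k"
    "invertible_mat M1" "invertible_mat M2" "invertible_mat (M1 - M2)"
    and x: "x \<in> carrier_mat k n" and d: "d \<in> carrier_mat k n" "d \<noteq> 0\<^sub>m k n"
  shows "distinct [x, x + M1 * d, x + M2 * d]"
proof -
  have "M1 * d \<noteq> 0\<^sub>m k n" "M2 * d \<noteq> 0\<^sub>m k n" "(M1 - M2) * d \<noteq> 0\<^sub>m k n"
    using invertible_mat_mult_eq_zero[of _ k d n] M d minus_carrier_mat[of M2 k k M1] by blast+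
  moreover have "(M1 - M2) * d = 0\<^sub>m k n" if "x + M1 * d = x + M2 * d"
  proof -
    have "M1 * d = M2 * d"
      using that x M d by (auto simp: mat_eq_iff)
    then show ?thesis
      using M d by (simp add: minus_mult_distrib_mat)
  qed
  ultimately show ?thesis
    using M x d add_mat_eq_self_iff[of x k n] by auto
qed

lemma card_pattern_free_le:
  fixes M1 M2 :: "'a :: {field, finite} mat"
  assumes M: "M1 \<in> carrier_mat k k" "M2 \<in> carrier_mat k k"
    "invertible_mat M1" "invertible_mat M2" "invertible_mat (M1 - M2)"
    and A: "A \<subseteq> carrier_mat k n" "finite A"
    and free: "\<not> (\<exists>x \<in> carrier_mat k n. \<exists>d \<in> carrier_mat k n.
            distinct [x, x + M1 * d, x + M2 * d] \<and> {x, x + M1 * d, x + M2 * d} \<subseteq> A)"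
  shows "card A \<le> 3 * card (low_degree ({..<k} \<times> {..<n}) (CARD('a) - 1))"
proof -
  obtain N1 where N1: "N1 \<in> carrier_mat k k" "N1 * M1 = 1\<^sub>m k" "M1 * N1 = 1\<^sub>m k"
    using invertible_mat_obtain_inverse M by blast
  obtain N2 where N2: "N2 \<in> carrier_mat k k" "N2 * M2 = 1\<^sub>m k" "M2 * N2 = 1\<^sub>m k"
    using invertible_mat_obtain_inverse M by blast
  \<comment> \<open>In the coordinates \<open>N2 a - N1 a\<close>, \<open>N1 b\<close>, \<open>- N2 c\<close> the pattern equation
    \<open>N1 (b - a) = N2 (c - a)\<close> no longer mixes different entries, so the indicator of the pattern
    is a product of trivariate polynomials, one for each entry.\<close>
  define u where "u a ij = (N2 * a) $$ ij - (N1 * a) $$ ij" for a ij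
  define v where "v b ij = (N1 * b) $$ ij" for b ij
  define w where "w c ij = - ((N2 * c) $$ ij)" for c ij
  show ?thesis
  proof (rule card_le_low_degree[of A _ u v w])
    fix a b c assume abc: "a \<in> A" "b \<in> A" "c \<in> A"
    then have car: "a \<in> carrier_mat k n" "b \<in> carrier_mat k n" "c \<in> carrier_mat k n"
      using A by auto
    show "(\<forall>ij\<in>{..<k} \<times> {..<n}. u a ij + v b ij + w c ij = 0) \<longleftrightarrow> a = b \<and> b = c"
    proof
      assume zero: "\<forall>ij\<in>{..<k} \<times> {..<n}. u a ij + v b ij + w c ij = 0"
      \<comment> \<open>The equation says that \<open>N1 * (b - a)\<close> and
        \<open>N2 * (c - a)\<close> agree, so this \<open>d\<close> generates the pattern
        \<open>a\<close>, \<open>b\<close>, \<open>c\<close>. As \<open>A\<close> contains no such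
        pattern with distinct points, \<open>d\<close> must be zero.\<close>
      define d where "d = N1 * (b - a)"
      have d: "d \<in> carrier_mat k n"
        using N1 car by (auto simp: d_def intro!: mult_carrier_mat[of _ k k])
      have "N1 * b - N1 * a = N2 * c - N2 * a"
      proof (rule eq_matI)
        fix i j assume "i < dim_row (N2 * c - N2 * a)" "j < dim_col (N2 * c - N2 * a)"
        then have ij: "i < k" "j < n"
          using N2 car by auto
        then have "u a (i, j) + v b (i, j) + w c (i, j) = 0"
          using zero by auto
        then have "(N1 * b) $$ (i, j) - (N1 * a) $$ (i, j) = (N2 * c) $$ (i, j) - (N2 * a) $$ (i, j)"
          by (simp add: u_def v_def w_def algebra_simps)
        then show "(N1 * b - N1 * a) $$ (i, j) = (N2 * c - N2 * a) $$ (i, j)"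
          using ij N1 N2 car by simp
      qed (use N1 N2 car in auto)
      then have d2: "d = N2 * (c - a)"
        using N1 N2 car by (simp add: d_def mult_minus_distrib_mat)
      have "M1 * d = b - a"
        using M N1 car left_mult_one_mat[of "b - a" k n] minus_carrier_mat[of a k n b]
          assoc_mult_mat[of M1 k k N1 k "b - a" n]
        by (simp add: d_def)
      moreover have "M2 * d = c - a"
        using M N2 car left_mult_one_mat[of "c - a" k n] minus_carrier_mat[of a k n c]
          assoc_mult_mat[of M2 k k N2 k "c - a" n]
        by (simp add: d2)
      moreover have "a + (b - a) = b" "a + (c - a) = c"
        using car by (auto simp: mat_eq_iff)
      ultimately have bc: "b = a + M1 * d" "c = a + M2 * d"
        by simp_all
      have "d = 0\<^sub>m k n"
        using free full_rank_pattern_distinct[OF M car(1) d] d abc car(1) bc by blast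
      then show "a = b \<and> b = c"
        using bc car M by simp
    qed (simp add: u_def v_def w_def)
  qed (use A in auto)
qed

theorem mainTheorem1:
  fixes q :: nat
  assumes "primepow q" and "odd q"
    and "CARD('a :: {field, finite}) = q"
  shows "\<exists>c :: real. 0.8414 * real q \<le> c \<and> c \<le> 0.9184 * real q \<and>
    (\<forall>(n :: nat) (k :: nat) (M1 :: 'a mat) (M2 :: 'a mat) (A :: 'a mat set).
       n > 0 \<and> k > 0 \<and>
       M1 \<in> carrier_mat k k \<and> M2 \<in> carrier_mat k k \<and>
       invertible_mat M1 \<and> invertible_mat M2 \<and> invertible_mat (M1 - M2) \<and>
       A \<subseteq> carrier_mat k n \<and>
       \<not> (\<exists>x \<in> carrier_mat k n. \<exists>d \<in> carrier_mat k n.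
            distinct [x, x + M1 * d, x + M2 * d] \<and>
            {x, x + M1 * d, x + M2 * d} \<subseteq> A)
       \<longrightarrow> real (card A) \<le> 3 * c ^ (k * n))"
\<comment> \<open>The upper end of the allowed interval serves as the constant, so its lower bound
  is immediate.\<close>
proof (intro exI[of _ "0.9184 * real q"] conjI allI impI)
  fix n k :: nat and M1 M2 :: "'a mat" and A :: "'a mat set"
  assume *: "n > 0 \<and> k > 0 \<and>
       M1 \<in> carrier_mat k k \<and> M2 \<in> carrier_mat k k \<and>
       invertible_mat M1 \<and> invertible_mat M2 \<and> invertible_mat (M1 - M2) \<and>
       A \<subseteq> carrier_mat k n \<and>
       \<not> (\<exists>x \<in> carrier_mat k n. \<exists>d \<in> carrier_mat k n.
            distinct [x, x + M1 * d, x + M2 * d] \<and>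
            {x, x + M1 * d, x + M2 * d} \<subseteq> A)"
  obtain p where p: "q = 2 * p + 1"
    using \<open>odd q\<close> by (elim oddE)
  have "p > 0"
    using primepow_gt_Suc_0[OF \<open>primepow q\<close>] p by auto
  show "real (card A) \<le> 3 * (0.9184 * real q) ^ (k * n)"
  \<comment> \<open>For infinite \<open>A\<close> the bound is trivial, since \<open>card A\<close>
    is then 0 by convention.\<close>
  proof (cases "finite A")
    case True
    let ?I = "{..<k} \<times> {..<n}"
    have "real (card A) \<le> 3 * real (card (low_degree ?I (2 * p)))"
      using card_pattern_free_le[of M1 k M2 A n] * True p assms(3) by auto
    also have "\<dots> \<le> 3 * (0.9184 * real (2 * p + 1)) ^ card ?I"
      using card_low_degree_le[of ?I p] \<open>p > 0\<close> by simp
    finally show ?thesis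
      by (simp add: p)
  qed simp
qed simp_all

end
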